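(* Let $q$ be an odd prime power. If $-1$ is not a square in $\mathbb{F}_q$, then $\overline{\mathcal{I}}(\mathbb{F}_q,2)=\frac{q+1}{2}$. If $-1$ is a square in $\mathbb{F}_q$, then $\frac{q-1}{2}\le\overline{\mathcal{I}}(\mathbb{F}_q,2)\le\frac{q+3}{2}$.
   Context: For $u,v\in\mathbb{F}_q^2$ let $d^2(u,v)=(u_1-v_1)^2+(u_2-v_2)^2\in\mathbb{F}_q$. Two points are at integral distance if $d^2(u,v)=t^2$ for some $t\in\mathbb{F}_q$ (so $0$ is allowed). An integral point set is a set of points pairwise at integral distance. Points of $\mathbb{F}_q^2$ are collinear if they lie on a common affine line. $\overline{\mathcal{I}}(\mathbb{F}_q,2)$ denotes the maximum cardinality of an integral point set in $\mathbb{F}_q^2$ containing no three (distinct) collinear points. *)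

theory Defs
  imports
    "HOL-Analysis.Finite_Cartesian_Product"
    "HOL-Analysis.Cartesian_Space"
    "HOL-Computational_Algebra.Nth_Powers"
    "HOL-Number_Theory.Prime_Powers"
begin

(* d2 takes values in the field itself; is_square x means x = t ^ 2 for some t,
   so 0 counts as a square. *)

definition d2 :: "'a::field ^ 2 \<Rightarrow> 'a ^ 2 \<Rightarrow> 'a" where
  "d2 u v = (u $ 1 - v $ 1) ^ 2 + (u $ 2 - v $ 2) ^ 2"

definition integral_distance :: "'a::field ^ 2 \<Rightarrow> 'a ^ 2 \<Rightarrow> bool" where
  "integral_distance u v \<longleftrightarrow> is_square (d2 u v)"

definition integral_point_set :: "('a::field ^ 2) set \<Rightarrow> bool" where
  "integral_point_set S \<longleftrightarrow> (\<forall>u\<in>S. \<forall>v\<in>S. integral_distance u v)"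

definition affine_line :: "('a::field ^ 2) set \<Rightarrow> bool" where
  "affine_line L \<longleftrightarrow> (\<exists>p v. v \<noteq> 0 \<and> L = range (\<lambda>t. p + t *s v))"

(* The library's collinear is restricted to real vector spaces. *)
definition collinear_points :: "('a::field ^ 2) set \<Rightarrow> bool" where
  "collinear_points S \<longleftrightarrow> (\<exists>L. affine_line L \<and> S \<subseteq> L)"

definition no_three_collinear :: "('a::field ^ 2) set \<Rightarrow> bool" where
  "no_three_collinear S \<longleftrightarrow>
     (\<forall>u\<in>S. \<forall>v\<in>S. \<forall>w\<in>S. u \<noteq> v \<and> u \<noteq> w \<and> v \<noteq> w \<longrightarrow> \<not> collinear_points {u, v, w})"

(* The type argument determines the field. *)
definition max_integral_no_three_collinear :: "'a::{field,finite} itself \<Rightarrow> nat" where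
  "max_integral_no_three_collinear _ =
     Max {card S |S :: ('a ^ 2) set. integral_point_set S \<and> no_three_collinear S}"

(* The Max above ranges over a finite nonempty set, so it is attained and is an upper bound. *)

lemma max_integral_no_three_collinear_attained:
  "\<exists>S :: ('a::{field,finite} ^ 2) set. integral_point_set S \<and> no_three_collinear S \<and>
     card S = max_integral_no_three_collinear TYPE('a)"
proof -
  let ?A = "{card S |S :: ('a ^ 2) set. integral_point_set S \<and> no_three_collinear S}"
  have "card ({} :: ('a ^ 2) set) \<in> ?A"
    by (force simp: integral_point_set_def no_three_collinear_def)
  then have "?A \<noteq> {}" by blast
  then have "Max ?A \<in> ?A" by (intro Max_in) simp_all
  then show ?thesis unfolding max_integral_no_three_collinear_def by auto
qed

lemma card_le_max_integral_no_three_collinear: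
  fixes S :: "('a::{field,finite} ^ 2) set"
  assumes "integral_point_set S" "no_three_collinear S"
  shows "card S \<le> max_integral_no_three_collinear TYPE('a)"
  unfolding max_integral_no_three_collinear_def
  by (rule Max_ge) (use assms in auto)

end

theory Submission
  imports Defs
begin

text \<open>
  Let \<open>D\<close> be the set of directions \<open>(a, b)\<close> for which \<open>a\<^sup>2 + b\<^sup>2\<close> is a square.
  In an integral point set without three collinear points, the points other than a fixed point \<open>u\<close>
  are seen from \<open>u\<close> in distinct directions of \<open>D\<close>, so there are at most \<open>card D + 1\<close> points.
  Equality would pair off the points along the vertical direction, which is impossible
  because \<open>card D\<close> is even by the symmetry \<open>m \<mapsto> -m\<close> of slopes.
  Conversely, every non-isotropic direction in \<open>D\<close> gives, by rational parametrization, a point of the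
  unit circle, and these points are pairwise at integral distance.
  Both cardinalities follow from counting the points of the hyperbola \<open>t\<^sup>2 = 1 + m\<^sup>2\<close>.
\<close>

section \<open>Two-to-one counting and odd characteristic\<close>

lemma is_square_iff: "is_square x \<longleftrightarrow> (\<exists>t. x = t ^ 2)"
  by (auto simp: is_nth_power_def)

lemma card_eq_double_image:
  assumes "finite A" and "\<And>x. x \<in> A \<Longrightarrow> card {y \<in> A. f y = f x} = 2"
  shows "card A = 2 * card (f ` A)"
proof -
  have "card A = (\<Sum>b\<in>f ` A. \<Sum>y\<in>{y \<in> A. f y = b}. 1)"
    using sum.image_gen[OF assms(1), of "\<lambda>_. 1::nat" f] by simp
  also have "\<dots> = (\<Sum>b\<in>f ` A. 2)"
    using assms(2) by (intro sum.cong) auto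
  finally show ?thesis by simp
qed

text \<open>In characteristic two, adding 1 is an involution without fixed points, so the pairs
  \<open>{x, x + 1}\<close> would split the field into two-element blocks.\<close>

lemma two_neq_zero_if_odd_card:
  assumes "odd CARD('a::{field,finite})"
  shows "(2 :: 'a) \<noteq> 0"
proof
  assume two: "(2 :: 'a) = 0"
  have "card {y \<in> UNIV. {y, y + 1} = {x, x + 1}} = 2" for x :: 'a
  proof -
    have "x + 1 + 1 = x"
      using two by (simp add: add.assoc)
    then have "{y \<in> UNIV. {y, y + 1} = {x, x + 1}} = {x, x + 1}"
      by (auto simp: doubleton_eq_iff)
    then show ?thesis by simp
  qed
  then have "CARD('a) = 2 * card ((\<lambda>y::'a. {y, y + 1}) ` UNIV)"
    by (intro card_eq_double_image) auto
  with assms show False by simp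
qed

section \<open>Slopes, directions and the rational parametrization of the circle\<close>

definition slopes :: "'a::field set" where
  "slopes = {m. is_square (1 + m ^ 2) \<and> 1 + m ^ 2 \<noteq> 0}"

definition isotropic_slopes :: "'a::field set" where
  "isotropic_slopes = {m. 1 + m ^ 2 = 0}"

text \<open>\<open>None\<close> encodes the vertical direction. It is also the value at
  \<open>v = u\<close>, so \<open>u\<close> itself has to be removed before counting
  directions.\<close>

definition direction :: "'a::field ^ 2 \<Rightarrow> 'a ^ 2 \<Rightarrow> 'a option" where
  "direction u v = (if v $ 1 = u $ 1 then None else Some ((v $ 2 - u $ 2) / (v $ 1 - u $ 1)))"

text \<open>For \<open>1 + m ^ 2\<close> nonzero, this is the second intersection of the unit circle
  with the line of slope \<open>m\<close> through (-1, 0).\<close>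

definition circle_point :: "'a::field \<Rightarrow> 'a ^ 2" where
  "circle_point m = vector [(1 - m ^ 2) / (1 + m ^ 2), 2 * m / (1 + m ^ 2)]"

text \<open>The extra point (-1, 0) belongs to the vertical direction, the parameter at
  infinity.\<close>

definition circle_set :: "('a::field ^ 2) set" where
  "circle_set = insert (vector [-1, 0]) (circle_point ` slopes)"

context
  assumes two [simp]: "(2 :: 'a::{field,finite}) \<noteq> 0"
begin

lemma four_neq_zero [simp]: "(4 :: 'a) \<noteq> 0"
proof -
  have "(4 :: 'a) = 2 * 2" by simp
  then show ?thesis by (metis mult_eq_0_iff two)
qed

lemma neg_eq_self_iff [simp]: "- x = x \<longleftrightarrow> x = 0" "x = - x \<longleftrightarrow> x = 0" for x :: 'a
proof -
  have "- x = x \<longleftrightarrow> 2 * x = 0"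
    by (metis add_eq_0_iff mult_2)
  then show "- x = x \<longleftrightarrow> x = 0" by simp
  then show "x = - x \<longleftrightarrow> x = 0" by metis
qed

section \<open>Counting slopes through the hyperbola\<close>

lemma card_square_roots:
  assumes "(x :: 'a) \<noteq> 0"
  shows "card {y. y ^ 2 = x ^ 2} = 2"
proof -
  have "{y. y ^ 2 = x ^ 2} = {x, - x}"
    by (auto simp: power2_eq_iff)
  then show ?thesis using assms by simp
qed

text \<open>The equation factors as \<open>(t - m) * (t + m) = 1\<close>, so
  \<open>s = m + t\<close> ranges over the nonzero elements and determines the point.\<close>

lemma card_hyperbola: "card {(m, t :: 'a). t ^ 2 = 1 + m ^ 2} = CARD('a) - 1"
proof -
  have "bij_betw (\<lambda>s. ((s - inverse s) / 2, (s + inverse s) / 2)) (UNIV - {0 :: 'a})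
          {(m, t). t ^ 2 = 1 + m ^ 2}"
  proof (rule bij_betw_byWitness[where f' = "\<lambda>(m, t). m + t"])
    show "\<forall>s\<in>UNIV - {0 :: 'a}. (case ((s - inverse s) / 2, (s + inverse s) / 2) of
            (m, t) \<Rightarrow> m + t) = s"
      by (auto simp: add_divide_distrib[symmetric])
    have inv: "inverse (m + t) = t - m" if "t ^ 2 = 1 + m ^ 2" for m t :: 'a
      by (rule inverse_unique) (use that in \<open>simp add: algebra_simps power2_eq_square\<close>)
    have "(m + t - inverse (m + t)) / 2 = m" "(m + t + inverse (m + t)) / 2 = t"
      if "t ^ 2 = 1 + m ^ 2" for m t :: 'a
      using inv[OF that] by (simp_all add: field_simps)
    then show "\<forall>p\<in>{(m, t :: 'a). t ^ 2 = 1 + m ^ 2}.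
        (((case p of (m, t) \<Rightarrow> m + t) - inverse (case p of (m, t) \<Rightarrow> m + t)) / 2,
         ((case p of (m, t) \<Rightarrow> m + t) + inverse (case p of (m, t) \<Rightarrow> m + t)) / 2) = p"
      by (clarify, simp only: prod.case simp_thms)
    have "((s + inverse s) / 2) ^ 2 = 1 + ((s - inverse s) / 2) ^ 2" if "s \<noteq> 0" for s :: 'a
    proof -
      have "(s + inverse s) ^ 2 = 2 ^ 2 + (s - inverse s) ^ 2"
        using that by (simp add: power2_eq_square algebra_simps)
      then show ?thesis by (simp add: power_divide divide_simps)
    qed
    then show "(\<lambda>s. ((s - inverse s) / 2, (s + inverse s) / 2)) ` (UNIV - {0 :: 'a})
        \<subseteq> {(m, t). t ^ 2 = 1 + m ^ 2}"
      by auto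
    show "(\<lambda>(m, t). m + t) ` {(m, t :: 'a). t ^ 2 = 1 + m ^ 2} \<subseteq> UNIV - {0}"
    proof -
      have "m + t \<noteq> 0" if "t ^ 2 = 1 + m ^ 2" for m t :: 'a
        using that by (auto simp: add_eq_0_iff)
      then show ?thesis by auto
    qed
  qed
  then have "card {(m, t :: 'a). t ^ 2 = 1 + m ^ 2} = card (UNIV - {0 :: 'a})"
    by (simp add: bij_betw_same_card)
  then show ?thesis by (simp add: card_Diff_singleton)
qed

text \<open>Projecting the hyperbola to \<open>m\<close> is two-to-one onto \<open>slopes\<close>,
  by the sign of \<open>t\<close>, and one-to-one onto \<open>isotropic_slopes\<close>, where
  \<open>t = 0\<close>.\<close>

lemma card_slopes: "2 * card (slopes :: 'a set) + card (isotropic_slopes :: 'a set) + 1 = CARD('a)"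
proof -
  let ?H = "{(m, t :: 'a). t ^ 2 = 1 + m ^ 2}"
  let ?A = "{(m, t :: 'a). t ^ 2 = 1 + m ^ 2 \<and> t \<noteq> 0}"
  let ?B = "(\<lambda>m. (m :: 'a, 0 :: 'a)) ` isotropic_slopes"
  have "card ?A = 2 * card (fst ` ?A)"
  proof (rule card_eq_double_image)
    fix p assume "p \<in> ?A"
    then obtain m t where p: "p = (m, t)" "t ^ 2 = 1 + m ^ 2" "t \<noteq> 0" by blast
    then have "{y \<in> ?A. fst y = fst p} = Pair m ` {y. y ^ 2 = t ^ 2}" by auto
    then show "card {y \<in> ?A. fst y = fst p} = 2"
      using card_square_roots[OF p(3)] by (simp add: card_image inj_on_def)
  qed simp
  moreover have "fst ` ?A = slopes"
    by (auto simp: slopes_def is_square_iff image_iff) metis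
  ultimately have "card ?A = 2 * card (slopes :: 'a set)" by (simp only:)
  moreover have "card ?B = card (isotropic_slopes :: 'a set)"
    by (simp add: card_image inj_on_def)
  moreover have "card ?H = card ?A + card ?B"
  proof -
    have "?A \<inter> ?B = {}" by auto
    then have "card (?A \<union> ?B) = card ?A + card ?B" by (rule card_Un_disjoint[OF finite finite])
    moreover have "?H = ?A \<union> ?B" by (auto simp: isotropic_slopes_def)
    ultimately show ?thesis by (simp only:)
  qed
  moreover have "CARD('a) \<noteq> 0" by simp
  moreover note card_hyperbola
  ultimately show ?thesis by presburger
qed

lemma card_isotropic_slopes:
  "card (isotropic_slopes :: 'a set) = (if is_square (-1 :: 'a) then 2 else 0)"
proof (cases "is_square (-1 :: 'a)")
  case True
  then obtain i :: 'a where i: "-1 = i ^ 2" by (auto simp: is_square_iff)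
  then have "(isotropic_slopes :: 'a set) = {m. m ^ 2 = i ^ 2}" "i \<noteq> 0"
    by (auto simp: isotropic_slopes_def add_eq_0_iff)
  then have "card (isotropic_slopes :: 'a set) = 2"
    using card_square_roots[of i] by metis
  with True show ?thesis by simp
next
  case False
  then have "(isotropic_slopes :: 'a set) = {}"
    by (auto simp: isotropic_slopes_def is_square_iff add_eq_0_iff) (metis minus_minus)
  with False show ?thesis by simp
qed

lemma slopes_Un_isotropic: "slopes \<union> isotropic_slopes = {m :: 'a. is_square (1 + m ^ 2)}"
  by (auto simp: slopes_def isotropic_slopes_def is_square_iff)

lemma card_slopes_Un_isotropic:
  "card (slopes \<union> isotropic_slopes :: 'a set)
    = card (slopes :: 'a set) + card (isotropic_slopes :: 'a set)"
  by (rule card_Un_disjoint) (auto simp: slopes_def isotropic_slopes_def)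

text \<open>Squaring pairs each nonzero \<open>m\<close> with \<open>-m\<close>, and the slope 0
  stays alone. This parity sharpens the upper bound by one.\<close>

lemma odd_card_integral_slopes: "odd (card {m :: 'a. is_square (1 + m ^ 2)})"
proof -
  let ?M = "{m :: 'a. is_square (1 + m ^ 2)}"
  have "card (?M - {0}) = 2 * card ((\<lambda>m. m ^ 2) ` (?M - {0}))"
  proof (rule card_eq_double_image)
    fix x assume x: "x \<in> ?M - {0}"
    then have "{y \<in> ?M - {0}. y ^ 2 = x ^ 2} = {y. y ^ 2 = x ^ 2}" by auto
    with x show "card {y \<in> ?M - {0}. y ^ 2 = x ^ 2} = 2"
      by (simp add: card_square_roots)
  qed simp
  moreover have "0 \<in> ?M" by (auto simp: is_square_iff intro: exI[of _ 1])
  then have "card ?M = Suc (card (?M - {0}))"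
    by (simp add: card.remove[of ?M 0] del: card_Diff_insert card_Diff_singleton)
  ultimately show ?thesis by (simp only: even_Suc dvd_triv_left simp_thms)
qed

section \<open>Upper bound by counting directions\<close>

lemma collinear_if_direction_eq:
  assumes "direction u v = direction u w" "v \<noteq> u" "w \<noteq> u"
  shows "collinear_points {u, v, w}"
proof -
  have "\<exists>t. w = u + t *s (v - u)"
  proof (cases "v $ 1 = u $ 1")
    case True
    with assms(1) have "w $ 1 = u $ 1"
      by (auto simp: direction_def split: if_splits)
    moreover have "v $ 2 \<noteq> u $ 2"
      using True assms(2) by (auto simp: vec_eq_iff forall_2)
    ultimately show ?thesis using True
      by (intro exI[of _ "(w $ 2 - u $ 2) / (v $ 2 - u $ 2)"]) (simp add: vec_eq_iff forall_2)
  next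
    case False
    with assms(1) have "w $ 1 \<noteq> u $ 1"
        "(v $ 2 - u $ 2) / (v $ 1 - u $ 1) = (w $ 2 - u $ 2) / (w $ 1 - u $ 1)"
      by (auto simp: direction_def split: if_splits)
    with False show ?thesis
      by (intro exI[of _ "(w $ 1 - u $ 1) / (v $ 1 - u $ 1)"])
         (auto simp: vec_eq_iff forall_2 eq_divide_eq diff_eq_eq add.commute mult.commute)
  qed
  then obtain t where "w = u + t *s (v - u)" ..
  moreover have "u = u + 0 *s (v - u)" "v = u + 1 *s (v - u)" by simp_all
  ultimately have "{u, v, w} \<subseteq> range (\<lambda>t. u + t *s (v - u))"
    by blast
  moreover have "affine_line (range (\<lambda>t. u + t *s (v - u)))"
    unfolding affine_line_def using assms(2)
    by (intro exI[of _ u] exI[of _ "v - u"]) simp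
  ultimately show ?thesis
    unfolding collinear_points_def by blast
qed

text \<open>For a non-vertical pair, dividing the squared distance by the square of the first
  coordinate difference gives 1 plus the squared slope.\<close>

lemma direction_integral:
  assumes "integral_distance u v"
  shows "direction u v \<in> insert None (Some ` {m. is_square (1 + m ^ 2)})"
proof (cases "v $ 1 = u $ 1")
  case False
  obtain t where t: "(u $ 1 - v $ 1) ^ 2 + (u $ 2 - v $ 2) ^ 2 = t ^ 2"
    using assms by (auto simp: integral_distance_def d2_def is_square_iff)
  have "1 + ((v $ 2 - u $ 2) / (v $ 1 - u $ 1)) ^ 2 = (t / (v $ 1 - u $ 1)) ^ 2"
    using False t by (simp add: power_divide field_simps) (simp add: power2_commute)
  with False show ?thesis by (auto simp: direction_def is_square_iff)
qed (simp add: direction_def)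

text \<open>Distinct directions alone give one more than this bound, since the vertical direction
  also counts; parity excludes the extra point.\<close>

lemma card_integral_no_three_collinear_le:
  fixes S :: "('a ^ 2) set"
  assumes "integral_point_set S" "no_three_collinear S"
  shows "card S \<le> card {m :: 'a. is_square (1 + m ^ 2)} + 1"
proof (rule ccontr)
  let ?D = "insert None (Some ` {m :: 'a. is_square (1 + m ^ 2)})"
  assume "\<not> ?thesis"
  moreover have card_D: "card ?D = card {m :: 'a. is_square (1 + m ^ 2)} + 1"
    by (simp add: card_image)
  ultimately have gt: "card S > card ?D" by simp
  have inj: "inj_on (direction u) (S - {u})" if "u \<in> S" for u
  proof (rule inj_onI, rule ccontr)
    fix v w
    assume *: "v \<in> S - {u}" "w \<in> S - {u}" "direction u v = direction u w" "v \<noteq> w"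
    then have "collinear_points {u, v, w}"
      by (intro collinear_if_direction_eq) auto
    moreover have "\<not> collinear_points {u, v, w}"
      using assms(2)[unfolded no_three_collinear_def, rule_format, of u v w] that * by auto
    ultimately show False by contradiction
  qed
  have sub: "direction u ` (S - {u}) \<subseteq> ?D" if "u \<in> S" for u
    using assms(1) that direction_integral[of u]
    unfolding integral_point_set_def by (intro image_subsetI) auto
  \<comment> \<open>By \<open>gt\<close>, at least \<open>card ?D\<close> points differ from
    \<open>u\<close>; as their directions are distinct members of \<open>?D\<close>, every direction
    occurs exactly once.\<close>
  have surj: "direction u ` (S - {u}) = ?D" "card S = card ?D + 1" if "u \<in> S" for u
  proof -
    have c: "card (direction u ` (S - {u})) = card S - 1"
      using inj[OF that] that by (simp add: card_image card_Diff_singleton)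
    with gt show "direction u ` (S - {u}) = ?D"
      by (intro card_seteq sub that) auto
    with c gt show "card S = card ?D + 1" by simp
  qed
  \<comment> \<open>Each point has exactly one partner on its vertical line: \<open>surj\<close>
    provides it and \<open>inj\<close> makes it unique.\<close>
  have "card S = 2 * card ((\<lambda>v. v $ 1) ` S)"
  proof (rule card_eq_double_image)
    fix u assume u: "u \<in> S"
    have "None \<in> direction u ` (S - {u})" using surj(1)[OF u] by blast
    then obtain v where "v \<in> S - {u}" "None = direction u v" by (rule imageE)
    then have v: "v \<in> S" "v \<noteq> u" "direction u v = None" by simp_all
    have "{y \<in> S. y $ 1 = u $ 1} = {u, v}"
    proof (intro equalityI subsetI)
      fix y assume y: "y \<in> {y \<in> S. y $ 1 = u $ 1}"
      then have "direction u y = direction u v" using v(3) by (simp add: direction_def)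
      then have "y \<in> S - {u} \<Longrightarrow> y = v"
        using inj_onD[OF inj[OF u]] v(1,2) by blast
      with y show "y \<in> {u, v}" by blast
    qed (use u v in \<open>auto simp: direction_def split: if_splits\<close>)
    with v show "card {y \<in> S. y $ 1 = u $ 1} = 2" by simp
  qed simp
  then have "even (card S)" by simp
  moreover obtain u where "u \<in> S" using gt by fastforce
  \<comment> \<open>\<open>card S\<close> exceeds the odd number of integral slopes by two: one for
    \<open>None\<close>, one for \<open>u\<close>.\<close>
  from surj(2)[OF this] have "odd (card S)"
    using card_D odd_card_integral_slopes by simp
  ultimately show False by simp
qed

section \<open>Lower bound from points of the unit circle\<close>

lemma no_three_collinear_unit_circle:
  fixes S :: "('a ^ 2) set"
  assumes circle: "\<And>u. u \<in> S \<Longrightarrow> (u $ 1) ^ 2 + (u $ 2) ^ 2 = 1"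
  shows "no_three_collinear S"
  unfolding no_three_collinear_def
proof (intro ballI impI notI)
  fix u v w
  assume S: "u \<in> S" "v \<in> S" "w \<in> S" and ne: "u \<noteq> v \<and> u \<noteq> w \<and> v \<noteq> w"
    and "collinear_points {u, v, w}"
  then obtain p d where d: "d \<noteq> 0" and "{u, v, w} \<subseteq> range (\<lambda>t. p + t *s d)"
    by (auto simp: collinear_points_def affine_line_def)
  then obtain a b c where "u = p + a *s d" "v = p + b *s d" "w = p + c *s d" by auto
  then have v: "v = u + (b - a) *s d" and w: "w = u + (c - a) *s d"
    by (auto simp: vec_eq_iff algebra_simps)
  define x y where "x = u $ 1" and "y = u $ 2"
  define k l where "k = d $ 1" and "l = d $ 2"
  have xy: "x ^ 2 + y ^ 2 = 1" using circle[OF S(1)] by (simp add: x_def y_def)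
  \<comment> \<open>Along the line through \<open>u\<close>, the circle equation is a quadratic in
    \<open>s\<close> with root 0; cancelling that root leaves a linear equation.\<close>
  have root: "s * (k ^ 2 + l ^ 2) + 2 * (x * k + y * l) = 0"
    if "u + s *s d \<in> S" "s \<noteq> 0" for s
  proof -
    have "(x + s * k) ^ 2 + (y + s * l) ^ 2 = x ^ 2 + y ^ 2"
      using circle[OF that(1)] xy by (simp add: x_def y_def k_def l_def)
    then have "s * (s * (k ^ 2 + l ^ 2) + 2 * (x * k + y * l)) = 0"
      by (simp add: power2_eq_square algebra_simps)
    with that(2) show ?thesis by simp
  qed
  have "b - a \<noteq> 0" "c - a \<noteq> 0" "b - a \<noteq> c - a" using ne v w by auto
  moreover from this root S v w
  have "(b - a) * (k ^ 2 + l ^ 2) + 2 * (x * k + y * l) = 0"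
       "(c - a) * (k ^ 2 + l ^ 2) + 2 * (x * k + y * l) = 0" by auto
  \<comment> \<open>A linear equation with two distinct roots has leading coefficient 0.\<close>
  ultimately have iso: "k ^ 2 + l ^ 2 = 0"
    by (metis add_right_cancel mult_cancel_right)
  then have "2 * (x * k + y * l) = 0"
    using root[of "b - a"] S v \<open>b - a \<noteq> 0\<close> by simp
  then have orth: "x * k + y * l = 0"
    by (metis mult_eq_0_iff two)
  text \<open>Lagrange's identity forces the isotropic \<open>d\<close> to be parallel as well as orthogonal to \<open>u\<close>.\<close>
  have "(x * l - y * k) ^ 2 = (x ^ 2 + y ^ 2) * (k ^ 2 + l ^ 2) - (x * k + y * l) ^ 2"
    by (simp add: power2_eq_square algebra_simps)
  then have "x * l - y * k = 0" using iso orth by simp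
  \<comment> \<open>Since \<open>u\<close> has norm 1, \<open>d\<close> is recovered from its dot
    product and its determinant with \<open>u\<close>, both of which vanish.\<close>
  moreover have "k = (x ^ 2 + y ^ 2) * k" "l = (x ^ 2 + y ^ 2) * l" using xy by simp_all
  moreover have "(x ^ 2 + y ^ 2) * k = x * (x * k + y * l) - y * (x * l - y * k)"
      "(x ^ 2 + y ^ 2) * l = y * (x * k + y * l) + x * (x * l - y * k)"
    by (simp_all add: power2_eq_square algebra_simps)
  ultimately have "k = 0" "l = 0" unfolding orth
    by (metis diff_self mult_zero_right, metis add_0 mult_zero_right)
  with d show False by (simp add: vec_eq_iff forall_2 k_def l_def)
qed

lemma slopeE:
  assumes "(m :: 'a) \<in> slopes"
  obtains t where "1 + m ^ 2 = t ^ 2" "t \<noteq> 0"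
  using assms by (auto simp: slopes_def is_square_iff)

lemma circle_point_fst: "1 + circle_point m $ 1 = 2 / (1 + m ^ 2)" if "(m :: 'a) \<in> slopes"
  using that by (simp add: circle_point_def slopes_def divide_simps)

lemma card_circle_set: "card (circle_set :: ('a ^ 2) set) = card (slopes :: 'a set) + 1"
proof -
  \<comment> \<open>The parameter is the slope of the chord from (-1, 0).\<close>
  have "m = circle_point m $ 2 / (1 + circle_point m $ 1)" if "m \<in> slopes" for m :: 'a
    using that by (simp add: circle_point_fst) (simp add: circle_point_def slopes_def)
  then have "inj_on circle_point (slopes :: 'a set)"
    by (metis inj_onI)
  moreover have "vector [-1, 0] \<noteq> circle_point m" if "m \<in> slopes" for m :: 'a
  proof
    assume eq: "vector [-1, 0] = circle_point m"
    have "1 + circle_point m $ 1 \<noteq> 0"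
      using that by (simp add: circle_point_fst slopes_def)
    then show False by (simp flip: eq)
  qed
  then have "(vector [-1, 0] :: 'a ^ 2) \<notin> circle_point ` slopes" by auto
  ultimately show ?thesis
    by (simp add: circle_set_def card_image)
qed

lemma no_three_collinear_circle_set: "no_three_collinear (circle_set :: ('a ^ 2) set)"
proof (rule no_three_collinear_unit_circle)
  fix u :: "'a ^ 2" assume "u \<in> circle_set"
  moreover have "(circle_point m $ 1) ^ 2 + (circle_point m $ 2) ^ 2 = 1" if "m \<in> slopes" for m :: 'a
  proof -
    have "(1 - m ^ 2) ^ 2 + (2 * m) ^ 2 = (1 + m ^ 2) ^ 2"
      by (simp add: power2_eq_square algebra_simps)
    with that show ?thesis
      by (simp add: circle_point_def slopes_def power_divide flip: add_divide_distrib)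
  qed
  ultimately show "(u $ 1) ^ 2 + (u $ 2) ^ 2 = 1"
    by (auto simp: circle_set_def)
qed

lemma integral_distance_commute: "integral_distance u v \<longleftrightarrow> integral_distance v u"
  for u v :: "'a ^ 2"
  by (simp add: integral_distance_def d2_def power2_commute)

text \<open>The squared distance is \<open>4 * (m - n) ^ 2 / ((1 + m ^ 2) * (1 + n ^ 2))\<close>
  between two parametrized points and \<open>4 / (1 + m ^ 2)\<close> from (-1, 0); the denominators
  are squares for parameters in \<open>slopes\<close>.\<close>

lemma integral_point_set_circle_set: "integral_point_set (circle_set :: ('a ^ 2) set)"
proof -
  have pm: "integral_distance (vector [-1, 0]) (circle_point m)" if "m \<in> slopes" for m :: 'a
  proof -
    from that obtain t where t: "1 + m ^ 2 = t ^ 2" "t \<noteq> 0" by (rule slopeE)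
    have "(circle_point m $ 1 + 1) ^ 2 + (circle_point m $ 2) ^ 2
        = (2 ^ 2 + (2 * m) ^ 2) / (t ^ 2) ^ 2"
      using circle_point_fst[OF that] t
      by (simp add: circle_point_def power_divide add_divide_distrib add.commute)
    also have "2 ^ 2 + (2 * m) ^ 2 = 2 ^ 2 * t ^ 2"
      using t(1) by (simp add: power_mult_distrib distrib_left flip: t(1))
    also have "\<dots> / (t ^ 2) ^ 2 = (2 / t) ^ 2"
      using t(2) by (simp add: power_divide field_simps)
    finally show ?thesis
      by (auto simp: integral_distance_def d2_def is_square_iff power2_commute[of "- 1"])
  qed
  moreover have "integral_distance (circle_point m) (circle_point n)"
    if "m \<in> slopes" "n \<in> slopes" for m n :: 'a
  proof -
    from that(1) obtain s where s: "1 + m ^ 2 = s ^ 2" "s \<noteq> 0" by (rule slopeE)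
    from that(2) obtain t where t: "1 + n ^ 2 = t ^ 2" "t \<noteq> 0" by (rule slopeE)
    have "d2 (circle_point m) (circle_point n)
        = (((1 - m ^ 2) * t ^ 2 - (1 - n ^ 2) * s ^ 2) ^ 2 + (2 * m * t ^ 2 - 2 * n * s ^ 2) ^ 2)
          / (s ^ 2 * t ^ 2) ^ 2"
      using s t by (simp add: d2_def circle_point_def diff_frac_eq power_divide add_divide_distrib)
    \<comment> \<open>The two differences are \<open>2 * (n ^ 2 - m ^ 2)\<close> and
      \<open>2 * (m - n) * (1 - m * n)\<close>, and
      \<open>(m + n) ^ 2 + (1 - m * n) ^ 2 = (1 + m ^ 2) * (1 + n ^ 2)\<close>.\<close>
    also have "((1 - m ^ 2) * t ^ 2 - (1 - n ^ 2) * s ^ 2) ^ 2 + (2 * m * t ^ 2 - 2 * n * s ^ 2) ^ 2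
        = (2 * (m - n)) ^ 2 * (s ^ 2 * t ^ 2)"
      by (simp flip: s(1) t(1)) (simp add: power2_eq_square algebra_simps)
    also have "\<dots> / (s ^ 2 * t ^ 2) ^ 2 = (2 * (m - n) / (s * t)) ^ 2"
      using s(2) t(2) by (simp add: power_divide power_mult_distrib power2_eq_square)
    finally show ?thesis by (auto simp: integral_distance_def is_square_iff)
  qed
  moreover have "integral_distance u u" for u :: "'a ^ 2"
    by (auto simp: integral_distance_def d2_def is_square_iff intro: exI[of _ 0])
  ultimately show ?thesis
    unfolding integral_point_set_def circle_set_def
    using integral_distance_commute by blast
qed

section \<open>Assembling the bounds\<close>

lemma max_integral_no_three_collinear_bounds:
  "card (slopes :: 'a set) + 1 \<le> max_integral_no_three_collinear TYPE('a)"
  "max_integral_no_three_collinear TYPE('a)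
    \<le> card (slopes :: 'a set) + card (isotropic_slopes :: 'a set) + 1"
proof -
  show "card (slopes :: 'a set) + 1 \<le> max_integral_no_three_collinear TYPE('a)"
    using card_le_max_integral_no_three_collinear[OF integral_point_set_circle_set
        no_three_collinear_circle_set]
    by (simp add: card_circle_set)
  obtain S :: "('a ^ 2) set" where "integral_point_set S" "no_three_collinear S"
      "card S = max_integral_no_three_collinear TYPE('a)"
    using max_integral_no_three_collinear_attained by blast
  then show "max_integral_no_three_collinear TYPE('a)
    \<le> card (slopes :: 'a set) + card (isotropic_slopes :: 'a set) + 1"
    using card_integral_no_three_collinear_le[of S]
    by (simp add: slopes_Un_isotropic flip: card_slopes_Un_isotropic)
qed

end

theorem corollary4:
  fixes q :: nat
  assumes "primepow q" and "odd q"
    and "CARD('a::{field,finite}) = q"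
  shows "(\<not> is_square (-1 :: 'a) \<longrightarrow>
            real (max_integral_no_three_collinear TYPE('a)) = (real q + 1) / 2)
       \<and> (is_square (-1 :: 'a) \<longrightarrow>
            (real q - 1) / 2 \<le> real (max_integral_no_three_collinear TYPE('a))
          \<and> real (max_integral_no_three_collinear TYPE('a)) \<le> (real q + 3) / 2)"
proof -
  have two: "(2 :: 'a) \<noteq> 0"
    using assms by (intro two_neq_zero_if_odd_card) simp
  \<comment> \<open>If -1 is not a square, there are \<open>(q - 1) / 2\<close> slopes and no
    isotropic ones, so both bounds coincide. Otherwise there are \<open>(q - 3) / 2\<close> slopes
    and two isotropic ones, which leaves a gap of 2.\<close>
  note facts = card_slopes[OF two] card_isotropic_slopes[OF two]
    max_integral_no_three_collinear_bounds[OF two] assms(3)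
  show ?thesis
    using facts by (auto split: if_splits)
qed

end
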